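(* Let $u^*\in\mathcal{U}$ be the strong solution of the PDE described in the context. Given $\gamma>0$, let $(u^\dagger,\boldsymbol{z}^\dagger)$ be a solution of $$\min_{\boldsymbol{z}\in\mathbb{R}^{\overline{R}},\,u\in\mathcal{U}_Q}\ \big|[\boldsymbol{\psi},u]-\boldsymbol{z}\big|^2+\gamma\|u\|_{\mathcal{U}_Q}^2\quad\text{s.t. } F(\boldsymbol{z})=\boldsymbol{y},$$ where $u^\dagger=(S_{\overline{\boldsymbol{x}}}^*S_{\overline{\boldsymbol{x}}}+\gamma I)^{-1}S_{\overline{\boldsymbol{x}}}^*\boldsymbol{z}^\dagger$ and $\boldsymbol{z}^\dagger$ is a minimizer of $\boldsymbol{z}^T(\mathcal{Q}(\boldsymbol{\psi},\boldsymbol{\psi})+\gamma I)^{-1}\boldsymbol{z}$ over $\boldsymbol{z}\in\mathbb{R}^{\overline{R}}$ subject to $F(\boldsymbol{z})=\boldsymbol{y}$. Then $$\begin{aligned}\|u^\dagger-u^*\|_{\mathcal{U}}\leq{}&\inf_{\psi\in\operatorname{span}(\boldsymbol{\psi})}\|u^*-\mathcal{K}\psi\|_{\mathcal{U}}+\gamma\sqrt{[\boldsymbol{\psi},u^*]^T\mathcal{K}(\boldsymbol{\psi},\boldsymbol{\psi})^{-3}[\boldsymbol{\psi},u^*]}\\&+\sqrt{3}\,|\boldsymbol{z}^\dagger|\sqrt{\big\|(\gamma I+\mathcal{Q}(\boldsymbol{\psi},\boldsymbol{\psi}))^{-1}-(\gamma I+\mathcal{K}(\boldsymbol{\psi},\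boldsymbol{\psi}))^{-1}\big\|}\\&+\sqrt{(\boldsymbol{z}^\dagger-[\boldsymbol{\psi},u^*])^T\mathcal{K}(\boldsymbol{\psi},\boldsymbol{\psi})^{-1}(\boldsymbol{z}^\dagger-[\boldsymbol{\psi},u^*])}.\end{aligned}$$
   Context: Space. $\Omega\subset\mathbb{R}^d$ ($d\geq1$) is a bounded open domain with boundary $\partial\Omega$. $\mathcal{U}$ is a Banach space of real functions on $\overline{\Omega}$ with dual $\mathcal{U}^*$ and duality pairing $[\cdot,\cdot]$ between $\mathcal{U}^*$ and $\mathcal{U}$. There is a linear bijection $\mathcal{K}:\mathcal{U}^*\to\mathcal{U}$ that is symmetric ($[\phi,\mathcal{K}\varphi]=[\varphi,\mathcal{K}\phi]$) and positive ($[\phi,\mathcal{K}\phi]>0$ for $\phi\neq0$), and $\|u\|_{\mathcal{U}}^2=[\mathcal{K}^{-1}u,u]$, with inner product $\langle u,v\rangle=[\mathcal{K}^{-1}u,v]$. Point evaluations $\delta_{\boldsymbol{x}}$, $\boldsymbol{x}\in\overline\Omega$, belong to $\mathcal{U}^*$, so $\mathcal{U}$ is the RKHS of $K(\boldsymbol{x},\boldsymbol{x}')=[\delta_{\boldsymbol{x}},\mathcal{K}\delta_{\boldsymbol{x}'}]$. For vectors of functionals $\boldsymbol{\alpha}=(\alpha_i)$, $\boldsymbol{\beta}=(\beta_j)$ in $\mathcal{U}^*$: $[\boldsymbol{\alpha},u]$ is the vector $([\alpha_i,u])_i$, $\mathcal{K}\boldsymbol{\alpha}$ is the vector of functions $(\mathcal{K}\alpha_i)_i$,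 and $\mathcal{K}(\boldsymbol{\alpha},\boldsymbol{\beta})$ is the matrix with entries $[\alpha_i,\mathcal{K}\beta_j]$ (a single functional is a vector of length one); similarly for other operators such as $\mathcal{Q}$ below. PDE. $1\leq D_b\leq D$; $L_1,\dots,L_{D_b}:\mathcal{U}\to C(\partial\Omega)$ and $L_{D_b+1},\dots,L_D:\mathcal{U}\to C(\Omega)$ are bounded linear operators; $P:\mathbb{R}^{D-D_b}\to\mathbb{R}$ and $B:\mathbb{R}^{D_b}\to\mathbb{R}$ are (possibly nonlinear) functions; $f,g$ are given functions on $\Omega$, $\partial\Omega$. It is assumed that the PDE $P(L_{D_b+1}(u^* )(\boldsymbol{x}),\dots,L_D(u^* )(\boldsymbol{x}))=f(\boldsymbol{x})$ for $\boldsymbol{x}\in\Omega$, $B(L_1(u^* )(\boldsymbol{x}),\dots,L_{D_b}(u^* )(\boldsymbol{x}))=g(\boldsymbol{x})$ for $\boldsymbol{x}\in\partial\Omega$, has a unique strong solution $u^*\in\mathcal{U}$. Inducing points. $\widehat{\boldsymbol{x}}_1,\dots,\widehat{\boldsymbol{x}}_{M_\Omega}\in\Omega$, $\widehat{\boldsymbol{x}}_{M_\Omega+1},\dots,\widehat{\boldsymbol{x}}_M\in\partial\Omega$. $\boldsymbol{\phi}$ is the vector of all functionals $\delta_{\widehat{\boldsymbol{x}}_j}\circ L_i$ with ($1\leq i\leq D_b$, $M_\Omega+1\leq j\leq M$) or ($D_b+1\leq i\leq D$, $1\leq j\leq M_\Omega$); its entries are assumed linearly independent in $\mathcal{U}^*$.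 Put $\Theta=\mathcal{K}(\boldsymbol{\phi},\boldsymbol{\phi})$ (invertible), and let $\mathcal{Q}:\mathcal{U}^*\to\mathcal{U}$ be given by $[\varphi,\mathcal{Q}\varphi']=\mathcal{K}(\varphi,\boldsymbol{\phi})\Theta^{-1}\mathcal{K}(\boldsymbol{\phi},\varphi')$. $\mathcal{U}_Q\subset\mathcal{U}$ is the RKHS of the kernel $Q(\boldsymbol{x},\boldsymbol{x}')=[\delta_{\boldsymbol{x}},\mathcal{Q}\delta_{\boldsymbol{x}'}]$. Samples. $\boldsymbol{x}_1,\dots,\boldsymbol{x}_{N_\Omega}\in\Omega$, $\boldsymbol{x}_{N_\Omega+1},\dots,\boldsymbol{x}_N\in\partial\Omega$, $\overline{\boldsymbol{x}}=\{\boldsymbol{x}_i\}_{i=1}^N$. $\boldsymbol{\psi}$ is the vector, ordered first by $i$ and then by $j$, of the functionals $\psi_j^{(i)}=\delta_{\boldsymbol{x}_j}\circ L_i$ with ($1\leq i\leq D_b$, $N_\Omega+1\leq j\leq N$) or ($D_b+1\leq i\leq D$, $1\leq j\leq N_\Omega$); its length is $\overline{R}=(N-N_\Omega)D_b+N_\Omega(D-D_b)$. The entries of $\boldsymbol{\psi}$ are assumed linearly independent in $\mathcal{U}^*$, so that $\mathcal{K}(\boldsymbol{\psi},\boldsymbol{\psi})$ is invertible. Vectors $\boldsymbol{z}\in\mathbb{R}^{\overline{R}}$ are indexed correspondingly as $z_j^{(i)}$. $\boldsymbol{y}\in\mathbb{R}^N$ has $y_j=f(\boldsymbol{x}_j)$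 for $j\leq N_\Omega$ and $y_j=g(\boldsymbol{x}_j)$ for $j>N_\Omega$. $F:\mathbb{R}^{\overline{R}}\to\mathbb{R}^N$ is $(F(\boldsymbol{z}))_j=P(z_j^{(D_b+1)},\dots,z_j^{(D)})$ for $j\leq N_\Omega$ and $(F(\boldsymbol{z}))_j=B(z_j^{(1)},\dots,z_j^{(D_b)})$ for $j>N_\Omega$. Sampling operator. $S_{\overline{\boldsymbol{x}}}:\mathcal{U}_Q\to\mathbb{R}^{\overline{R}}$, $S_{\overline{\boldsymbol{x}}}u=[\boldsymbol{\psi},u]$; its adjoint (with respect to the inner product of $\mathcal{U}_Q$ and the Euclidean one) is $S_{\overline{\boldsymbol{x}}}^*c=c^T\mathcal{Q}\boldsymbol{\psi}$. $I$ denotes an identity map or matrix; $|\cdot|$ is the Euclidean norm and $\|A\|$ the spectral norm of a matrix $A$. *)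

theory Defs
  imports
    "HOL-Analysis.Bounded_Linear_Function"
    "Jordan_Normal_Form.Gauss_Jordan_Elimination"
begin

section \<open>Function spaces\<close>

text \<open>
  A Banach space of real functions on a set \<open>X\<close> is a type \<open>'u\<close> of class \<open>banach\<close> together with an
  evaluation map \<open>ev :: 'u \<Rightarrow> 'a \<Rightarrow> real\<close>: the element \<open>u\<close> is the function \<open>ev u\<close> on \<open>X\<close>.
  Two elements with the same values on \<open>X\<close> are equal, and every point evaluation is linear and
  bounded, hence an element of the dual, which is the type \<open>'u \<Rightarrow>\<^sub>L real\<close>.
\<close>

definition function_space_on :: "'a set \<Rightarrow> ('u::banach \<Rightarrow> 'a \<Rightarrow> real) \<Rightarrow> bool" where
  "function_space_on X ev \<longleftrightarrow>
     (\<forall>u v. (\<forall>x\<in>X. ev u x = ev v x) \<longrightarrow> u = v) \<and>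
     (\<forall>x\<in>X. bounded_linear (\<lambda>u. ev u x))"

text \<open>
  \<open>at_point L x\<close> is the functional \<open>\<delta>\<^sub>x \<circ> L\<close>; in particular \<open>at_point ev x\<close> is \<open>\<delta>\<^sub>x\<close>.
  \<open>Blinfun\<close> is only meaningful on bounded linear maps.
\<close>

definition at_point :: "('u::real_normed_vector \<Rightarrow> 'a \<Rightarrow> real) \<Rightarrow> 'a \<Rightarrow> ('u \<Rightarrow>\<^sub>L real)" where
  "at_point L x = Blinfun (\<lambda>u. L u x)"

text \<open>
  Bounded linear operators into \<open>C(S)\<close>, where \<open>C(S)\<close> has the topology of uniform convergence on
  compact subsets of \<open>S\<close>. For compact \<open>S\<close> this is boundedness for the sup norm on \<open>S\<close>;
  for open \<open>S\<close>, an operator bounded for the sup norm on \<open>S\<close> is in particular bounded in this sense.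
\<close>

definition bounded_operator_into_C ::
    "'a::topological_space set \<Rightarrow> ('u::real_normed_vector \<Rightarrow> 'a \<Rightarrow> real) \<Rightarrow> bool" where
  "bounded_operator_into_C S L \<longleftrightarrow>
     (\<forall>u. continuous_on S (L u)) \<and>
     (\<forall>x\<in>S. linear (\<lambda>u. L u x)) \<and>
     (\<forall>C. compact C \<and> C \<subseteq> S \<longrightarrow> (\<exists>b. \<forall>u. \<forall>x\<in>C. \<bar>L u x\<bar> \<le> b * norm u))"

text \<open>
  \<open>(H, ip)\<close> is the reproducing kernel Hilbert space, consisting of elements of the function
  space \<open>'u\<close>, of the kernel \<open>k\<close> on \<open>X\<close>.
\<close>

definition is_inner_product_on :: "'u::real_vector set \<Rightarrow> ('u \<Rightarrow> 'u \<Rightarrow> real) \<Rightarrow> bool" where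
  "is_inner_product_on H ip \<longleftrightarrow>
     (\<forall>u\<in>H. \<forall>v\<in>H. \<forall>w\<in>H. \<forall>a b. ip (a *\<^sub>R u + b *\<^sub>R v) w = a * ip u w + b * ip v w) \<and>
     (\<forall>u\<in>H. \<forall>v\<in>H. ip u v = ip v u) \<and>
     (\<forall>u\<in>H. u \<noteq> 0 \<longrightarrow> ip u u > 0)"

definition is_hilbert_on :: "'u::real_vector set \<Rightarrow> ('u \<Rightarrow> 'u \<Rightarrow> real) \<Rightarrow> bool" where
  "is_hilbert_on H ip \<longleftrightarrow>
     subspace H \<and> is_inner_product_on H ip \<and>
     (\<forall>s::nat \<Rightarrow> 'u. range s \<subseteq> H \<and>
        (\<forall>e>0. \<exists>n0. \<forall>m\<ge>n0. \<forall>n\<ge>n0. sqrt (ip (s m - s n) (s m - s n)) < e) \<longrightarrow>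
        (\<exists>l\<in>H. (\<lambda>n. sqrt (ip (s n - l) (s n - l))) \<longlonglongrightarrow> 0))"

definition is_rkhs ::
    "'a set \<Rightarrow> ('u::banach \<Rightarrow> 'a \<Rightarrow> real) \<Rightarrow> ('a \<Rightarrow> 'a \<Rightarrow> real) \<Rightarrow>
     'u set \<Rightarrow> ('u \<Rightarrow> 'u \<Rightarrow> real) \<Rightarrow> bool" where
  "is_rkhs X ev k H ip \<longleftrightarrow>
     is_hilbert_on H ip \<and>
     (\<forall>x\<in>X. \<exists>h\<in>H. (\<forall>x'\<in>X. ev h x' = k x' x) \<and> (\<forall>u\<in>H. ip u h = ev u x))"

section \<open>Vectors and matrices\<close>

definition vnorm :: "real vec \<Rightarrow> real" where
  "vnorm v = sqrt (scalar_prod v v)"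

definition spectral_norm :: "real mat \<Rightarrow> real" where
  "spectral_norm A = (SUP v \<in> {v \<in> carrier_vec (dim_col A). vnorm v \<le> 1}. vnorm (A *\<^sub>v v))"

text \<open>Only meaningful on invertible square matrices, where it is the two-sided inverse.\<close>

definition minv :: "real mat \<Rightarrow> real mat" where
  "minv A = the (mat_inverse A)"

definition quad_form :: "real mat \<Rightarrow> real vec \<Rightarrow> real" where
  "quad_form A v = scalar_prod v (A *\<^sub>v v)"

text \<open>
  For vectors of functionals \<open>\<alpha>\<close>, \<open>\<beta>\<close> (lists) and an operator \<open>T\<close> from the dual to \<open>'u\<close>:
  \<open>pairing \<alpha> u = [\<alpha>, u]\<close> and \<open>op_mat T \<alpha> \<beta> = T(\<alpha>, \<beta>)\<close>.
\<close>

definition pairing :: "('u::real_normed_vector \<Rightarrow>\<^sub>L real) list \<Rightarrow> 'u \<Rightarrow> real vec" where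
  "pairing \<alpha> u = vec (length \<alpha>) (\<lambda>k. blinfun_apply (\<alpha> ! k) u)"

definition op_mat ::
    "(('u::real_normed_vector \<Rightarrow>\<^sub>L real) \<Rightarrow> 'u) \<Rightarrow>
     ('u \<Rightarrow>\<^sub>L real) list \<Rightarrow> ('u \<Rightarrow>\<^sub>L real) list \<Rightarrow> real mat" where
  "op_mat T \<alpha> \<beta> =
     mat (length \<alpha>) (length \<beta>) (\<lambda>(k, l). blinfun_apply (\<alpha> ! k) (T (\<beta> ! l)))"

definition lin_indep_list :: "'v::real_vector list \<Rightarrow> bool" where
  "lin_indep_list vs \<longleftrightarrow> distinct vs \<and> independent (set vs)"

section \<open>Collocation functionals\<close>

text \<open>
  With \<open>n\<close> points, of which those numbered \<open>1..n\<^sub>\<Omega>\<close> are interior and \<open>n\<^sub>\<Omega>+1..n\<close> are on the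
  boundary, the functional \<open>\<delta>\<^bsub>x j\<^esub> \<circ> L i\<close> occurs for boundary operators (\<open>i \<le> D\<^sub>b\<close>) at boundary
  points and for interior operators (\<open>i > D\<^sub>b\<close>) at interior points. The pairs \<open>(i, j)\<close> are listed
  first by \<open>i\<close> and then by \<open>j\<close>.
\<close>

definition colloc_index :: "nat \<Rightarrow> nat \<Rightarrow> nat \<Rightarrow> nat \<Rightarrow> (nat \<times> nat) list" where
  "colloc_index Db D n\<Omega> n =
     concat (map (\<lambda>i. map (Pair i) (if i \<le> Db then [n\<Omega>+1..<n+1] else [1..<n\<Omega>+1])) [1..<D+1])"

definition colloc_functionals ::
    "(nat \<Rightarrow> 'u::real_normed_vector \<Rightarrow> 'a \<Rightarrow> real) \<Rightarrow> (nat \<Rightarrow> 'a) \<Rightarrow>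
     (nat \<times> nat) list \<Rightarrow> ('u \<Rightarrow>\<^sub>L real) list" where
  "colloc_functionals L x idx = map (\<lambda>(i, j). at_point (L i) (x j)) idx"

definition colloc_dim :: "nat \<Rightarrow> nat \<Rightarrow> nat \<Rightarrow> nat \<Rightarrow> nat" where
  "colloc_dim Db D n\<Omega> n = (n - n\<Omega>) * Db + n\<Omega> * (D - Db)"

text \<open>\<open>entry idx z i j\<close> is the component of the vector \<open>z\<close> at the index pair \<open>(i, j)\<close>.\<close>

definition entry :: "(nat \<times> nat) list \<Rightarrow> real vec \<Rightarrow> nat \<Rightarrow> nat \<Rightarrow> real" where
  "entry idx z i j = vec_index z (THE k. k < length idx \<and> idx ! k = (i, j))"

lemma set_colloc_index:
  "set (colloc_index Db D n\<Omega> n) =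
     {(i, j). 1 \<le> i \<and> i \<le> D \<and>
        (if i \<le> Db then n\<Omega> + 1 \<le> j \<and> j \<le> n else 1 \<le> j \<and> j \<le> n\<Omega>)}"
proof -
  have "set (colloc_index Db D n\<Omega> n) =
      (\<Union>i\<in>{1..<D+1}. Pair i ` (if i \<le> Db then {n\<Omega>+1..<n+1} else {1..<n\<Omega>+1}))"
    unfolding colloc_index_def set_concat set_map image_image set_upt if_distrib[of set] ..
  also have "\<dots> = {(i, j). i \<in> {1..<D+1} \<and>
      j \<in> (if i \<le> Db then {n\<Omega>+1..<n+1} else {1..<n\<Omega>+1})}"
    by blast
  finally show ?thesis by auto
qed

lemma length_colloc_index:
  assumes "Db \<le> D"
  shows "length (colloc_index Db D n\<Omega> n) = colloc_dim Db D n\<Omega> n"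
proof -
  have "length (colloc_index Db D n\<Omega> n) = (\<Sum>i\<leftarrow>[1..<D+1]. if i \<le> Db then n - n\<Omega> else n\<Omega>)"
    unfolding colloc_index_def length_concat map_map
    by (intro arg_cong[where f = sum_list] map_cong) auto
  also have "[1..<D+1] = [1..<Db+1] @ [Db+1..<D+1]"
    using assms upt_add_eq_append[of 1 "Db+1" "D-Db"] by simp
  also have "(\<Sum>i\<leftarrow>([1..<Db+1] @ [Db+1..<D+1]). if i \<le> Db then n - n\<Omega> else n\<Omega>) =
      (\<Sum>i\<leftarrow>[1..<Db+1]. n - n\<Omega>) + (\<Sum>i\<leftarrow>[Db+1..<D+1]. n\<Omega>)"
    unfolding map_append sum_list_append
    by (intro arg_cong2[where f = plus] arg_cong[where f = sum_list] map_cong) auto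
  finally show ?thesis
    by (simp add: colloc_dim_def sum_list_triv mult.commute del: upt_Suc)
qed

lemma distinct_colloc_index: "distinct (colloc_index Db D n\<Omega> n)"
proof -
  have "distinct (concat (map (\<lambda>i. map (Pair i) (f i)) xs))"
    if "distinct xs" "\<And>i. distinct (f i)" for f :: "nat \<Rightarrow> nat list" and xs
    using that by (induction xs) (auto simp: distinct_map inj_on_def)
  then show ?thesis
    unfolding colloc_index_def by simp
qed

lemma entry_nth:
  assumes "distinct idx" "k < length idx" "idx ! k = (i, j)"
  shows "entry idx z i j = vec_index z k"
proof -
  have "(THE k. k < length idx \<and> idx ! k = (i, j)) = k"
    using assms nth_eq_iff_index_eq[OF assms(1)] by (intro the_equality) metis+
  then show ?thesis by (simp add: entry_def)
qed

section \<open>The PDE and its collocated form\<close>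

definition strong_solution ::
    "'a::topological_space set \<Rightarrow> nat \<Rightarrow> nat \<Rightarrow> (nat \<Rightarrow> 'u \<Rightarrow> 'a \<Rightarrow> real) \<Rightarrow>
     (real vec \<Rightarrow> real) \<Rightarrow> (real vec \<Rightarrow> real) \<Rightarrow> ('a \<Rightarrow> real) \<Rightarrow> ('a \<Rightarrow> real) \<Rightarrow> 'u \<Rightarrow> bool" where
  "strong_solution \<Omega> Db D L P B f g u \<longleftrightarrow>
     (\<forall>x\<in>\<Omega>. P (vec (D - Db) (\<lambda>k. L (Db + 1 + k) u x)) = f x) \<and>
     (\<forall>x\<in>frontier \<Omega>. B (vec Db (\<lambda>k. L (1 + k) u x)) = g x)"

text \<open>Component \<open>j\<close> of a vector in \<open>\<real>\<^sup>N\<close> belongs to sample point number \<open>j + 1\<close>.\<close>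

definition constraint_map ::
    "nat \<Rightarrow> nat \<Rightarrow> nat \<Rightarrow> nat \<Rightarrow> (real vec \<Rightarrow> real) \<Rightarrow> (real vec \<Rightarrow> real) \<Rightarrow> real vec \<Rightarrow> real vec" where
  "constraint_map Db D n\<Omega> n P B z =
     (let c = entry (colloc_index Db D n\<Omega> n) z in
      vec n (\<lambda>j. if j + 1 \<le> n\<Omega> then P (vec (D - Db) (\<lambda>k. c (Db + 1 + k) (j + 1)))
                 else B (vec Db (\<lambda>k. c (1 + k) (j + 1)))))"

definition data_vec ::
    "nat \<Rightarrow> nat \<Rightarrow> (nat \<Rightarrow> 'a) \<Rightarrow> ('a \<Rightarrow> real) \<Rightarrow> ('a \<Rightarrow> real) \<Rightarrow> real vec" where
  "data_vec n\<Omega> n x f g = vec n (\<lambda>j. if j + 1 \<le> n\<Omega> then f (x (j + 1)) else g (x (j + 1)))"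

section \<open>Sampling operator\<close>

text \<open>
  The sampling operator is \<open>pairing \<psi>\<close>, restricted to the space \<open>U\<^sub>Q\<close>; its adjoint is
  \<open>c \<mapsto> c\<^sup>T Q\<psi>\<close>. The inverse of \<open>S\<^sup>* S + \<gamma> I\<close> is that of an operator on \<open>U\<^sub>Q\<close>.
\<close>

definition sampling_adjoint ::
    "(('u::real_normed_vector \<Rightarrow>\<^sub>L real) \<Rightarrow> 'u) \<Rightarrow> ('u \<Rightarrow>\<^sub>L real) list \<Rightarrow> real vec \<Rightarrow> 'u" where
  "sampling_adjoint Q \<psi> c = (\<Sum>k<length \<psi>. vec_index c k *\<^sub>R Q (\<psi> ! k))"

definition regularized_inverse ::
    "(('u::real_normed_vector \<Rightarrow>\<^sub>L real) \<Rightarrow> 'u) \<Rightarrow> 'u set \<Rightarrow> ('u \<Rightarrow>\<^sub>L real) list \<Rightarrow> real \<Rightarrow> 'u \<Rightarrow> 'u"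
  where
  "regularized_inverse Q UQ \<psi> \<gamma> =
     inv_into UQ (\<lambda>u. sampling_adjoint Q \<psi> (pairing \<psi> u) + \<gamma> *\<^sub>R u)"

end

theory Submission
  imports Defs "HOL-Analysis.Convex" "Jordan_Normal_Form.Determinant"
begin

text \<open>
  Write \<open>A = K(\<psi>,\<psi>)\<close>, \<open>C = Q(\<psi>,\<psi>)\<close>, \<open>z = z\<^sup>\<dagger>\<close>, \<open>b = [\<psi>, u\<^sup>*]\<close>, and let \<open>T\<close> be the projection with \<open>Q = K T\<close>.
  Then \<open>u\<^sup>\<dagger> = K (a \<cdot> T\<psi>)\<close> with \<open>(C + \<gamma>) a = z\<close>. The triangle inequality is applied along the chain
  \<open>u\<^sup>\<dagger>\<close>, \<open>K (e \<cdot> \<psi>)\<close> with \<open>(A + \<gamma>) e = z\<close>, \<open>K (\<psi> \<cdot> (A + \<gamma>)\<^sup>-\<^sup>1 b)\<close>, \<open>K (\<psi> \<cdot> A\<^sup>-\<^sup>1 b)\<close>, \<open>u\<^sup>*\<close>.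
  The first distance squared equals \<open>z \<cdot> (a - e) - \<gamma> |a - e|\<^sup>2\<close>, where \<open>a - e = ((C + \<gamma>)\<^sup>-\<^sup>1 - (A + \<gamma>)\<^sup>-\<^sup>1) z\<close>;
  the second and third are bounded because \<open>(A + \<gamma>)\<^sup>-\<^sup>1 A\<close> is a contraction for the quadratic form of \<open>A\<close>;
  the last is the distance of \<open>u\<^sup>*\<close> to the span of \<open>K \<psi>\<close>.
\<close>

section \<open>Real vectors and matrices\<close>

lemma scalar_prod_self_nonneg: "0 \<le> scalar_prod (v :: real vec) v"
  unfolding scalar_prod_def by (intro sum_nonneg) auto

lemma scalar_prod_self_eq_0:
  fixes v :: "real vec"
  assumes "v \<in> carrier_vec n" "scalar_prod v v = 0"
  shows "v = 0\<^sub>v n"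
proof -
  have "v $ i = 0" if "i < n" for i
    using assms that by (auto simp: scalar_prod_def sum_nonneg_eq_0_iff)
  then show ?thesis using assms(1) by (intro eq_vecI) auto
qed

lemma vnorm_nonneg: "0 \<le> vnorm v"
  by (simp add: vnorm_def scalar_prod_self_nonneg)

lemma vnorm_power2: "(vnorm v)\<^sup>2 = scalar_prod v v"
  by (simp add: vnorm_def scalar_prod_self_nonneg)

lemma vnorm_smult: "vnorm (c \<cdot>\<^sub>v v) = \<bar>c\<bar> * vnorm v"
proof -
  have "scalar_prod (c \<cdot>\<^sub>v v) (c \<cdot>\<^sub>v v) = c\<^sup>2 * scalar_prod v v"
    by (simp add: power2_eq_square)
  then show ?thesis by (simp add: vnorm_def real_sqrt_mult)
qed

lemma abs_scalar_prod_le: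
  assumes "v \<in> carrier_vec n" "w \<in> carrier_vec n"
  shows "\<bar>scalar_prod v w\<bar> \<le> vnorm v * vnorm w"
proof -
  have "(scalar_prod v w)\<^sup>2 \<le> scalar_prod v v * scalar_prod w w"
    using Cauchy_Schwarz_ineq_sum[of "($) v" "($) w" "{0..<n}"] assms
    by (simp add: scalar_prod_def power2_eq_square)
  then have "sqrt ((scalar_prod v w)\<^sup>2) \<le> sqrt (scalar_prod v v * scalar_prod w w)"
    by (rule real_sqrt_le_mono)
  then show ?thesis by (simp add: vnorm_def real_sqrt_mult)
qed

text \<open>Cauchy-Schwarz in each row. The bound makes the set under the supremum in
  \<open>spectral_norm\<close> bounded above, without which that supremum carries no
  information.\<close>

lemma vnorm_mult_mat_vec_le_frobenius:
  assumes "v \<in> carrier_vec (dim_col A)" "vnorm v \<le> 1"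
  shows "vnorm (A *\<^sub>v v) \<le> sqrt (\<Sum>i<dim_row A. (vnorm (row A i))\<^sup>2)"
proof -
  have "(scalar_prod (row A i) v)\<^sup>2 \<le> (vnorm (row A i))\<^sup>2" for i
  proof -
    have "\<bar>scalar_prod (row A i) v\<bar> \<le> vnorm (row A i) * vnorm v"
      using assms(1) by (intro abs_scalar_prod_le[of _ "dim_col A"]) auto
    also have "\<dots> \<le> vnorm (row A i) * 1"
      using assms(2) vnorm_nonneg by (intro mult_left_mono) auto
    finally show ?thesis using power_mono[of _ _ 2] by fastforce
  qed
  then show ?thesis
    by (auto simp: vnorm_def[of "A *\<^sub>v v"] scalar_prod_def[of "A *\<^sub>v v"] lessThan_atLeast0
        power2_eq_square intro!: sum_mono)
qed

lemma vnorm_mult_mat_vec_le: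
  assumes "v \<in> carrier_vec (dim_col A)"
  shows "vnorm (A *\<^sub>v v) \<le> spectral_norm A * vnorm v"
proof -
  let ?U = "{v \<in> carrier_vec (dim_col A). vnorm v \<le> 1}"
  have bdd: "bdd_above ((\<lambda>v. vnorm (A *\<^sub>v v)) ` ?U)"
    using vnorm_mult_mat_vec_le_frobenius by (auto intro!: bdd_aboveI2)
  show ?thesis
  proof (cases "vnorm v = 0")
    case True
    then have "scalar_prod v v = 0" by (metis vnorm_power2 zero_power2)
    then have "v = 0\<^sub>v (dim_col A)" using assms scalar_prod_self_eq_0 by blast
    then have "A *\<^sub>v v = 0\<^sub>v (dim_row A)" by auto
    then show ?thesis using True by (simp add: vnorm_def)
  next
    case False
    define w where "w = inverse (vnorm v) \<cdot>\<^sub>v v"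
    have pos: "vnorm v > 0" using False vnorm_nonneg[of v] by simp
    then have "vnorm w = 1" by (simp add: w_def vnorm_smult)
    then have "w \<in> ?U" using assms by (simp add: w_def)
    then have "vnorm (A *\<^sub>v w) \<le> spectral_norm A"
      unfolding spectral_norm_def by (intro cSUP_upper bdd)
    moreover have "A *\<^sub>v w = inverse (vnorm v) \<cdot>\<^sub>v (A *\<^sub>v v)"
      unfolding w_def using assms by (intro mult_mat_vec) auto
    ultimately show ?thesis
      using pos by (simp add: vnorm_smult field_simps)
  qed
qed

lemma scalar_prod_mult_mat_vec_le:
  assumes "A \<in> carrier_mat n n" "v \<in> carrier_vec n"
  shows "scalar_prod v (A *\<^sub>v v) \<le> (vnorm v)\<^sup>2 * spectral_norm A"
proof -
  have "scalar_prod v (A *\<^sub>v v) \<le> vnorm v * vnorm (A *\<^sub>v v)"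
    using abs_scalar_prod_le[of v n "A *\<^sub>v v"] assms by auto
  also have "\<dots> \<le> vnorm v * (spectral_norm A * vnorm v)"
    using assms vnorm_nonneg vnorm_mult_mat_vec_le[of v A] by (intro mult_left_mono) auto
  finally show ?thesis by (simp add: power2_eq_square mult_ac)
qed

text \<open>\<open>minv\<close> takes \<open>the\<close> of an option. A trivial kernel forces a
  nonzero determinant, so \<open>mat_inverse\<close> does return an inverse.\<close>

lemma minv_inverse:
  assumes A: "A \<in> carrier_mat n n"
    and inj: "\<And>v. v \<in> carrier_vec n \<Longrightarrow> A *\<^sub>v v = 0\<^sub>v n \<Longrightarrow> v = 0\<^sub>v n"
  shows "minv A \<in> carrier_mat n n" "A * minv A = 1\<^sub>m n" "minv A * A = 1\<^sub>m n"
proof -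
  have "det A \<noteq> 0" using det_0_iff_vec_prod_zero_field[OF A] inj by blast
  then have "A \<in> Units (ring_mat TYPE(real) n ())" by (rule det_non_zero_imp_unit[OF A])
  then obtain B where "mat_inverse A = Some B" using mat_inverse(1)[OF A] by fastforce
  with mat_inverse(2)[OF A this]
  show "minv A \<in> carrier_mat n n" "A * minv A = 1\<^sub>m n" "minv A * A = 1\<^sub>m n"
    by (auto simp: minv_def)
qed

lemma minv_mult_vec:
  assumes A: "A \<in> carrier_mat n n"
    and inj: "\<And>v. v \<in> carrier_vec n \<Longrightarrow> A *\<^sub>v v = 0\<^sub>v n \<Longrightarrow> v = 0\<^sub>v n"
    and v: "v \<in> carrier_vec n"
  shows "minv A *\<^sub>v v \<in> carrier_vec n" "A *\<^sub>v (minv A *\<^sub>v v) = v" "minv A *\<^sub>v (A *\<^sub>v v) = v"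
proof -
  note B = minv_inverse[OF A inj]
  show "minv A *\<^sub>v v \<in> carrier_vec n" using B(1) v by (intro mult_mat_vec_carrier)
  show "A *\<^sub>v (minv A *\<^sub>v v) = v"
    using assoc_mult_mat_vec[OF A B(1) v] B(2) v by simp
  show "minv A *\<^sub>v (A *\<^sub>v v) = v"
    using assoc_mult_mat_vec[OF B(1) A v] B(3) v by simp
qed

section \<open>Regularized systems with a symmetric positive semidefinite matrix\<close>

definition sym_psd :: "nat \<Rightarrow> real mat \<Rightarrow> bool" where
  "sym_psd n A \<longleftrightarrow> A \<in> carrier_mat n n \<and>
     (\<forall>v\<in>carrier_vec n. \<forall>w\<in>carrier_vec n. scalar_prod v (A *\<^sub>v w) = scalar_prod w (A *\<^sub>v v)) \<and>
     (\<forall>v\<in>carrier_vec n. 0 \<le> scalar_prod v (A *\<^sub>v v))"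

lemma smult_one_add_mult_vec:
  fixes A :: "real mat"
  assumes "A \<in> carrier_mat n n" "v \<in> carrier_vec n"
  shows "(c \<cdot>\<^sub>m 1\<^sub>m n + A) *\<^sub>v v = A *\<^sub>v v + c \<cdot>\<^sub>v v"
proof -
  have "(c \<cdot>\<^sub>m 1\<^sub>m n + A) *\<^sub>v v = (c \<cdot>\<^sub>m 1\<^sub>m n) *\<^sub>v v + A *\<^sub>v v"
    using assms by (intro add_mult_distrib_mat_vec) auto
  also have "(c \<cdot>\<^sub>m 1\<^sub>m n) *\<^sub>v v = c \<cdot>\<^sub>v v"
    using assms by (intro eq_vecI) auto
  finally show ?thesis using assms by (auto intro: comm_add_vec)
qed

lemma regularized_injective:
  assumes A: "sym_psd n A" and "c > 0" and v: "v \<in> carrier_vec n"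
    and 0: "A *\<^sub>v v + c \<cdot>\<^sub>v v = 0\<^sub>v n"
  shows "v = 0\<^sub>v n"
proof -
  have Av: "A *\<^sub>v v \<in> carrier_vec n" using A v by (auto simp: sym_psd_def)
  have "scalar_prod v (A *\<^sub>v v) + c * scalar_prod v v = scalar_prod v (A *\<^sub>v v + c \<cdot>\<^sub>v v)"
    using v Av by (simp add: scalar_prod_add_distrib[of _ n])
  then have "scalar_prod v (A *\<^sub>v v) + c * scalar_prod v v = 0"
    using 0 v by simp
  moreover have "0 \<le> scalar_prod v (A *\<^sub>v v)" using A v by (auto simp: sym_psd_def)
  moreover have "0 \<le> c * scalar_prod v v" using \<open>c > 0\<close> scalar_prod_self_nonneg[of v] by simp
  ultimately have "c * scalar_prod v v = 0" by linarith
  with \<open>c > 0\<close> show ?thesis using v scalar_prod_self_eq_0 by auto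
qed

lemma regularized_minv:
  assumes A: "sym_psd n A" and c: "c > 0" and v: "v \<in> carrier_vec n"
  defines "G \<equiv> minv (c \<cdot>\<^sub>m 1\<^sub>m n + A)"
  shows "G \<in> carrier_mat n n" "G *\<^sub>v v \<in> carrier_vec n"
    "A *\<^sub>v (G *\<^sub>v v) + c \<cdot>\<^sub>v (G *\<^sub>v v) = v" "G *\<^sub>v (A *\<^sub>v v + c \<cdot>\<^sub>v v) = v"
proof -
  have Ac: "A \<in> carrier_mat n n" using A by (simp add: sym_psd_def)
  then have C: "c \<cdot>\<^sub>m 1\<^sub>m n + A \<in> carrier_mat n n" by simp
  have inj: "w = 0\<^sub>v n" if "w \<in> carrier_vec n" "(c \<cdot>\<^sub>m 1\<^sub>m n + A) *\<^sub>v w = 0\<^sub>v n" for w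
    using regularized_injective[OF A c that(1)] that smult_one_add_mult_vec[OF Ac that(1)] by simp
  show "G \<in> carrier_mat n n" unfolding G_def by (rule minv_inverse(1)[OF C inj])
  show G: "G *\<^sub>v v \<in> carrier_vec n" unfolding G_def by (rule minv_mult_vec(1)[OF C inj v])
  show "A *\<^sub>v (G *\<^sub>v v) + c \<cdot>\<^sub>v (G *\<^sub>v v) = v"
    using minv_mult_vec(2)[OF C inj v] smult_one_add_mult_vec[OF Ac G, of c] by (simp add: G_def)
  show "G *\<^sub>v (A *\<^sub>v v + c \<cdot>\<^sub>v v) = v"
    using minv_mult_vec(3)[OF C inj v] smult_one_add_mult_vec[OF Ac v, of c] by (simp add: G_def)
qed

text \<open>Expand the form of A at p - q. Pairing \<open>eq\<close> with q turns the cross term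
  q.Ap into q.Aq + c q.q, which leaves q.Aq + 2c q.q \<le> p.Ap.\<close>

lemma quad_form_shrink:
  assumes A: "sym_psd n A" and p: "p \<in> carrier_vec n" and q: "q \<in> carrier_vec n" and "c \<ge> 0"
    and eq: "A *\<^sub>v q + c \<cdot>\<^sub>v q = A *\<^sub>v p"
  shows "quad_form A q \<le> quad_form A p"
proof -
  have Ac: "A \<in> carrier_mat n n"
    and sym: "scalar_prod p (A *\<^sub>v q) = scalar_prod q (A *\<^sub>v p)"
    using A p q by (auto simp: sym_psd_def)
  have car: "A *\<^sub>v p \<in> carrier_vec n" "A *\<^sub>v q \<in> carrier_vec n" using Ac p q by auto
  have "scalar_prod q (A *\<^sub>v q) + c * scalar_prod q q = scalar_prod q (A *\<^sub>v q + c \<cdot>\<^sub>v q)"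
    using q car by (simp add: scalar_prod_add_distrib[of _ n])
  then have *: "scalar_prod q (A *\<^sub>v p) = scalar_prod q (A *\<^sub>v q) + c * scalar_prod q q"
    using eq by simp
  have "0 \<le> scalar_prod (p - q) (A *\<^sub>v (p - q))"
    using A p q by (simp add: sym_psd_def)
  also have "A *\<^sub>v (p - q) = A *\<^sub>v p - A *\<^sub>v q"
    using Ac p q by (rule mult_minus_distrib_mat_vec)
  also have "scalar_prod (p - q) (A *\<^sub>v p - A *\<^sub>v q) =
      scalar_prod p (A *\<^sub>v p) - 2 * scalar_prod q (A *\<^sub>v p) + scalar_prod q (A *\<^sub>v q)"
    using p q car sym
    by (simp add: minus_scalar_prod_distrib[of _ n] scalar_prod_minus_distrib[of _ n])
  finally have "scalar_prod q (A *\<^sub>v q) + 2 * (c * scalar_prod q q) \<le> scalar_prod p (A *\<^sub>v p)"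
    using * by simp
  moreover have "0 \<le> c * scalar_prod q q" using \<open>c \<ge> 0\<close> scalar_prod_self_nonneg by simp
  ultimately show ?thesis unfolding quad_form_def by linarith
qed

text \<open>If C is the Gram matrix of T\<psi> both with itself and with \<psi>, and A that of
  \<psi>, the left side is the squared distance between K(a.T\<psi>) and K(b.\<psi>). Pairing the
  equation for a with a and b, and the one for b with b, removes both matrices; symmetry of C
  handles the cross term.\<close>

lemma regularized_difference:
  assumes A: "A \<in> carrier_mat n n" and C: "sym_psd n C"
    and a: "a \<in> carrier_vec n" and b: "b \<in> carrier_vec n"
    and Ca: "C *\<^sub>v a + c \<cdot>\<^sub>v a = z" and Ab: "A *\<^sub>v b + c \<cdot>\<^sub>v b = z"
  shows "scalar_prod a (C *\<^sub>v a) - 2 * scalar_prod a (C *\<^sub>v b) + scalar_prod b (A *\<^sub>v b)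
    = scalar_prod z (a - b) - c * scalar_prod (a - b) (a - b)"
proof -
  have Cc: "C \<in> carrier_mat n n"
    and sym: "scalar_prod a (C *\<^sub>v b) = scalar_prod b (C *\<^sub>v a)"
    using C a b by (auto simp: sym_psd_def)
  have car: "C *\<^sub>v a \<in> carrier_vec n" "A *\<^sub>v b \<in> carrier_vec n" using A Cc a b by auto
  then have z: "z \<in> carrier_vec n" using Ab b by auto
  have "scalar_prod v z = scalar_prod v (C *\<^sub>v a) + c * scalar_prod v a"
    if v: "v \<in> carrier_vec n" for v
    unfolding Ca[symmetric] using v a car by (simp add: scalar_prod_add_distrib[of _ n])
  moreover have "scalar_prod b z = scalar_prod b (A *\<^sub>v b) + c * scalar_prod b b"
    unfolding Ab[symmetric] using b car by (simp add: scalar_prod_add_distrib[of _ n])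
  moreover have "scalar_prod z (a - b) = scalar_prod a z - scalar_prod b z"
    using a b z by (simp add: scalar_prod_minus_distrib[of _ n] comm_scalar_prod[of _ n])
  moreover have "scalar_prod (a - b) (a - b) =
      scalar_prod a a - 2 * scalar_prod b a + scalar_prod b b"
    using a b by (simp add: minus_scalar_prod_distrib[of _ n] scalar_prod_minus_distrib[of _ n]
        comm_scalar_prod[of a n b])
  ultimately show ?thesis unfolding \<open>scalar_prod (a - b) (a - b) = _\<close> using sym a b by (simp add: algebra_simps)
qed

section \<open>Gram matrices of functionals\<close>

definition vec_comb :: "real vec \<Rightarrow> 'v::real_vector list \<Rightarrow> 'v" where
  "vec_comb c xs = (\<Sum>k<length xs. c $ k *\<^sub>R xs ! k)"

lemma vec_comb_in_span: "vec_comb c xs \<in> span (set xs)"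
  unfolding vec_comb_def by (intro span_sum span_scale span_base) auto

text \<open>\<open>independent\<close> concerns sums over a set, \<open>vec_comb\<close> sums over
  positions. Distinctness makes indexing a bijection along which the coefficients are
  transported.\<close>

lemma vec_comb_eq_0_imp:
  assumes "lin_indep_list xs" "c \<in> carrier_vec (length xs)" "vec_comb c xs = 0"
  shows "c = 0\<^sub>v (length xs)"
proof -
  let ?n = "length xs"
  let ?i = "inv_into {..<?n} ((!) xs)"
  have bij: "bij_betw ((!) xs) {..<?n} (set xs)" and indep: "independent (set xs)"
    using assms(1) by (auto simp: lin_indep_list_def intro: bij_betw_nth)
  have inv: "?i (xs ! k) = k" if "k < ?n" for k
    using bij that by (auto simp: bij_betw_def inv_into_f_f)
  have "(\<Sum>v\<in>set xs. c $ ?i v *\<^sub>R v) = (\<Sum>k<?n. c $ ?i (xs ! k) *\<^sub>R xs ! k)"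
    by (rule sum.reindex_bij_betw[OF bij, symmetric])
  also have "\<dots> = 0" using assms(3) inv by (simp add: vec_comb_def)
  finally have sum0: "(\<Sum>v\<in>set xs. c $ ?i v *\<^sub>R v) = 0" .
  have "c $ ?i v = 0" if "v \<in> set xs" for v
    using independentD[OF indep _ subset_refl sum0 that] by simp
  then have "c $ k = 0" if "k < ?n" for k
    using inv that by (metis nth_mem)
  then show ?thesis using assms(2) by (intro eq_vecI) auto
qed

lemma blinfun_vec_comb:
  assumes "c \<in> carrier_vec (length \<alpha>)"
  shows "blinfun_apply (vec_comb c \<alpha>) u = scalar_prod c (pairing \<alpha> u)"
  by (simp add: vec_comb_def pairing_def scalar_prod_def blinfun.sum_left blinfun.scaleR_left
      lessThan_atLeast0)

lemma pairing_carrier [simp]: "pairing \<alpha> u \<in> carrier_vec (length \<alpha>)"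
  by (simp add: pairing_def)

lemma pairing_diff: "pairing \<alpha> (u - v) = pairing \<alpha> u - pairing \<alpha> v"
  by (intro eq_vecI) (auto simp: pairing_def blinfun.diff_right)

lemma op_mat_carrier [simp]: "op_mat T \<alpha> \<beta> \<in> carrier_mat (length \<alpha>) (length \<beta>)"
  by (simp add: op_mat_def)

lemma linear_vec_comb:
  assumes "linear T"
  shows "T (vec_comb d \<beta>) = vec_comb d (map T \<beta>)"
  using assms by (simp add: vec_comb_def linear_sum linear_scale)

text \<open>Linearity of \<open>T\<close> collects the columns into a single functional. This is the
  passage from matrix equations to statements about elements of the function space.\<close>

lemma op_mat_mult_vec:
  assumes "linear T" "d \<in> carrier_vec (length \<beta>)"
  shows "op_mat T \<alpha> \<beta> *\<^sub>v d = pairing \<alpha> (T (vec_comb d \<beta>))"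
proof (intro eq_vecI)
  fix k assume "k < dim_vec (pairing \<alpha> (T (vec_comb d \<beta>)))"
  then have k: "k < length \<alpha>" by (simp add: pairing_def)
  have "(op_mat T \<alpha> \<beta> *\<^sub>v d) $ k = (\<Sum>l<length \<beta>. blinfun_apply (\<alpha> ! k) (T (\<beta> ! l)) * d $ l)"
    using k assms(2) by (simp add: op_mat_def scalar_prod_def lessThan_atLeast0)
  also have "\<dots> = blinfun_apply (\<alpha> ! k) (T (vec_comb d \<beta>))"
    unfolding linear_vec_comb[OF assms(1)]
    by (simp add: vec_comb_def blinfun.sum_right blinfun.scaleR_right mult.commute)
  finally show "(op_mat T \<alpha> \<beta> *\<^sub>v d) $ k = pairing \<alpha> (T (vec_comb d \<beta>)) $ k"
    using k by (simp add: pairing_def)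
qed (simp add: pairing_def op_mat_def)

section \<open>The geometry that \<open>K\<close> induces on functionals and on the function
  space\<close>

locale covariance_operator =
  fixes K :: "('u::banach \<Rightarrow>\<^sub>L real) \<Rightarrow> 'u"
  assumes linear: "linear K" and bij: "bij K"
    and sym: "blinfun_apply \<alpha> (K \<beta>) = blinfun_apply \<beta> (K \<alpha>)"
    and pos: "\<alpha> \<noteq> 0 \<Longrightarrow> blinfun_apply \<alpha> (K \<alpha>) > 0"
    and norm_eq: "(norm u)\<^sup>2 = blinfun_apply (inv_into UNIV K u) u"
begin

lemma norm_K: "(norm (K \<mu>))\<^sup>2 = blinfun_apply \<mu> (K \<mu>)"
  by (simp add: norm_eq bij_is_inj[OF bij])

lemma nonneg: "0 \<le> blinfun_apply \<mu> (K \<mu>)"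
  using norm_K[of \<mu>] by (metis zero_le_power2)

text \<open>The preimage of u - v under \<open>K\<close> is a functional whose value at u - v is the
  squared norm of u - v.\<close>

lemma eq_of_functionals:
  fixes u v :: 'u
  assumes "\<And>\<alpha> :: 'u \<Rightarrow>\<^sub>L real. blinfun_apply \<alpha> u = blinfun_apply \<alpha> v"
  shows "u = v"
proof -
  have "(norm (u - v))\<^sup>2 = 0"
    using norm_eq[of "u - v"] assms[of "inv_into UNIV K (u - v)"] by (simp add: blinfun.diff_right)
  then show ?thesis by simp
qed

lemma norm_K_diff:
  "(norm (K \<mu> - K \<nu>))\<^sup>2 =
    blinfun_apply \<mu> (K \<mu>) - 2 * blinfun_apply \<mu> (K \<nu>) + blinfun_apply \<nu> (K \<nu>)"
  using sym[of \<nu> \<mu>] norm_K[of "\<mu> - \<nu>"]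
  by (simp add: linear_diff[OF linear] blinfun.diff_left blinfun.diff_right)

lemma gram:
  assumes "c \<in> carrier_vec (length \<alpha>)" "d \<in> carrier_vec (length \<beta>)"
  shows "blinfun_apply (vec_comb c \<alpha>) (K (vec_comb d \<beta>)) = scalar_prod c (op_mat K \<alpha> \<beta> *\<^sub>v d)"
  using assms by (simp add: blinfun_vec_comb op_mat_mult_vec[OF linear])

lemma gram_sym_psd: "sym_psd (length \<alpha>) (op_mat K \<alpha> \<alpha>)"
  unfolding sym_psd_def by (auto simp: gram[symmetric] nonneg intro: sym)

text \<open>The quadratic form of the Gram matrix at v is [\<mu>, K\<mu>] for the combination \<mu>
  with coefficients v. Positivity gives \<mu> = 0, then independence gives v = 0.\<close>

lemma gram_injective:
  assumes "lin_indep_list \<alpha>" "v \<in> carrier_vec (length \<alpha>)"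
    "op_mat K \<alpha> \<alpha> *\<^sub>v v = 0\<^sub>v (length \<alpha>)"
  shows "v = 0\<^sub>v (length \<alpha>)"
proof -
  have "blinfun_apply (vec_comb v \<alpha>) (K (vec_comb v \<alpha>)) = 0"
    using gram[of v \<alpha> v \<alpha>] assms by simp
  then have "vec_comb v \<alpha> = 0" using pos by (metis less_irrefl)
  then show ?thesis using assms vec_comb_eq_0_imp by blast
qed

lemma gram_minv:
  fixes \<alpha> :: "('u \<Rightarrow>\<^sub>L real) list"
  defines "A \<equiv> op_mat K \<alpha> \<alpha>"
  assumes "lin_indep_list \<alpha>"
  shows "minv A \<in> carrier_mat (length \<alpha>) (length \<alpha>)"
    and "v \<in> carrier_vec (length \<alpha>) \<Longrightarrow> minv A *\<^sub>v v \<in> carrier_vec (length \<alpha>)"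
    and "v \<in> carrier_vec (length \<alpha>) \<Longrightarrow> A *\<^sub>v (minv A *\<^sub>v v) = v"
  unfolding A_def using assms(2)
  by (auto intro: gram_injective minv_inverse(1) minv_mult_vec(1)
      intro!: minv_mult_vec(2)[of _ "length \<alpha>"])

lemma norm_K_vec_comb:
  assumes "c \<in> carrier_vec (length \<alpha>)"
  shows "norm (K (vec_comb c \<alpha>)) = sqrt (quad_form (op_mat K \<alpha> \<alpha>) c)"
proof -
  have "(norm (K (vec_comb c \<alpha>)))\<^sup>2 = quad_form (op_mat K \<alpha> \<alpha>) c"
    using assms by (simp add: norm_K gram quad_form_def)
  then show ?thesis by (metis norm_ge_zero real_sqrt_unique)
qed

lemma K_vec_comb_diff:
  assumes "c \<in> carrier_vec (length \<alpha>)" "d \<in> carrier_vec (length \<alpha>)"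
  shows "K (vec_comb (c - d) \<alpha>) = K (vec_comb c \<alpha>) - K (vec_comb d \<alpha>)"
  using assms
  by (simp add: vec_comb_def linear_diff[OF linear, symmetric] scaleR_diff_left sum_subtractf)

text \<open>These coefficients make every functional in \<psi> vanish on the residual w. By symmetry
  of \<open>K\<close>, w is then orthogonal to K\<beta> for \<beta> in the span, and Pythagoras
  gives the bound.\<close>

lemma interpolant_optimal:
  assumes indep: "lin_indep_list \<psi>" and \<alpha>: "\<alpha> \<in> span (set \<psi>)"
  shows "norm (u - K (vec_comb (minv (op_mat K \<psi> \<psi>) *\<^sub>v pairing \<psi> u) \<psi>)) \<le> norm (u - K \<alpha>)"
proof -
  define p where "p = minv (op_mat K \<psi> \<psi>) *\<^sub>v pairing \<psi> u"
  define w where "w = u - K (vec_comb p \<psi>)"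
  define \<beta> where "\<beta> = \<alpha> - vec_comb p \<psi>"
  \<comment> \<open>Surjectivity of \<open>K\<close> puts the residual into the form in which
    \<open>sym\<close> and \<open>norm_K_diff\<close> apply.\<close>
  obtain \<omega> where \<omega>: "w = K \<omega>" using bij by (metis bij_pointE)
  note A = gram_minv(2,3)[OF indep pairing_carrier[of \<psi> u]]
  have "pairing \<psi> w = 0\<^sub>v (length \<psi>)"
    using A by (simp add: w_def pairing_diff p_def op_mat_mult_vec[OF linear, symmetric])
  then have ann: "blinfun_apply (\<psi> ! k) w = 0" if "k < length \<psi>" for k
    using that unfolding pairing_def by (metis index_vec index_zero_vec(1))
  have "set \<psi> \<subseteq> {\<alpha>. blinfun_apply \<alpha> w = 0}"
    using ann by (auto simp: in_set_conv_nth)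
  moreover have "subspace {\<alpha>. blinfun_apply \<alpha> w = 0}"
    by (auto simp: subspace_def blinfun.add_left blinfun.scaleR_left)
  ultimately have "span (set \<psi>) \<subseteq> {\<alpha>. blinfun_apply \<alpha> w = 0}"
    by (rule span_minimal)
  moreover have "\<beta> \<in> span (set \<psi>)"
    unfolding \<beta>_def by (intro span_diff \<alpha> vec_comb_in_span)
  ultimately have "blinfun_apply \<beta> w = 0" by auto
  then have "blinfun_apply \<omega> (K \<beta>) = 0" using sym \<omega> by metis
  then have "(norm w)\<^sup>2 \<le> (norm (w - K \<beta>))\<^sup>2"
    using norm_K_diff[of \<omega> \<beta>] norm_K[of \<omega>] nonneg[of \<beta>] \<omega> by simp
  then have "norm w \<le> norm (w - K \<beta>)" by (rule power2_le_imp_le) simp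
  also have "w - K \<beta> = u - K \<alpha>" by (simp add: w_def \<beta>_def linear_diff[OF linear])
  finally show ?thesis unfolding w_def p_def .
qed

text \<open>With Ap = w and Aq + cq = w, \<open>quad_form_shrink\<close> compares q with p, and p.Ap
  is the form of the inverse of A at w.\<close>

lemma norm_regularized_le:
  assumes indep: "lin_indep_list \<psi>" and c: "c > 0" and w: "w \<in> carrier_vec (length \<psi>)"
  defines "A \<equiv> op_mat K \<psi> \<psi>"
  shows "norm (K (vec_comb (minv (c \<cdot>\<^sub>m 1\<^sub>m (length \<psi>) + A) *\<^sub>v w) \<psi>)) \<le> sqrt (quad_form (minv A) w)"
proof -
  let ?n = "length \<psi>"
  define q where "q = minv (c \<cdot>\<^sub>m 1\<^sub>m ?n + A) *\<^sub>v w"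
  define p where "p = minv A *\<^sub>v w"
  note R = regularized_minv[OF gram_sym_psd[of \<psi>] c w, folded A_def, folded q_def]
  note P = gram_minv(2,3)[OF indep w, folded A_def, folded p_def]
  have "quad_form A q \<le> quad_form A p"
    using c P R(3) gram_sym_psd[of \<psi>]
    by (intro quad_form_shrink[OF _ P(1) R(2), of _ c]) (auto simp: A_def)
  also have "\<dots> = quad_form (minv A) w"
    using P w by (simp add: quad_form_def p_def comm_scalar_prod[of _ ?n])
  finally show ?thesis
    using norm_K_vec_comb[of q \<psi>] R(2) by (simp add: A_def q_def)
qed

text \<open>Let Ap = b, Ar = p and Aq + cq = b. Then p - q solves the regularized system with right
  side cp = A(cr), so \<open>quad_form_shrink\<close> bounds its form by that of cr, which is
  \<open>c\<^sup>2\<close> times the cubic inverse form at b.\<close>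

lemma norm_regularization_bias_le:
  assumes indep: "lin_indep_list \<psi>" and c: "c > 0" and b: "b \<in> carrier_vec (length \<psi>)"
  defines "A \<equiv> op_mat K \<psi> \<psi>"
  shows "norm (K (vec_comb (minv (c \<cdot>\<^sub>m 1\<^sub>m (length \<psi>) + A) *\<^sub>v b) \<psi>) - K (vec_comb (minv A *\<^sub>v b) \<psi>))
    \<le> c * sqrt (quad_form (minv A ^\<^sub>m 3) b)"
proof -
  let ?n = "length \<psi>"
  define q where "q = minv (c \<cdot>\<^sub>m 1\<^sub>m ?n + A) *\<^sub>v b"
  define p where "p = minv A *\<^sub>v b"
  define r where "r = minv A *\<^sub>v p"
  have Ac: "A \<in> carrier_mat ?n ?n" by (simp add: A_def)
  note R = regularized_minv[OF gram_sym_psd[of \<psi>] c b, folded A_def, folded q_def]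
  note inv = gram_minv(2,3)[OF indep, folded A_def]
  note G = gram_minv(1)[OF indep, folded A_def]
  note P = inv[OF b, folded p_def]
  note S = inv[OF P(1), folded r_def]
  have psd: "sym_psd ?n A" by (simp add: A_def gram_sym_psd)
  have Aq: "A *\<^sub>v q \<in> carrier_vec ?n" using Ac R(2) by auto
  have "A *\<^sub>v (p - q) + c \<cdot>\<^sub>v (p - q) = (A *\<^sub>v p - A *\<^sub>v q) + c \<cdot>\<^sub>v (p - q)"
    using mult_minus_distrib_mat_vec[OF Ac P(1) R(2)] by simp
  also have "\<dots> = (b + c \<cdot>\<^sub>v p) - (A *\<^sub>v q + c \<cdot>\<^sub>v q)"
    using P(1) R(2) b Aq Ac unfolding P(2) by (intro eq_vecI) (auto simp: algebra_simps)
  also have "\<dots> = c \<cdot>\<^sub>v p"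
    unfolding R(3) using P b by (intro eq_vecI) auto
  also have "\<dots> = A *\<^sub>v (c \<cdot>\<^sub>v r)"
    using mult_mat_vec[OF Ac S(1)] S(2) by simp
  finally have "quad_form A (p - q) \<le> quad_form A (c \<cdot>\<^sub>v r)"
    using c P(1) R(2) S(1) by (intro quad_form_shrink[OF psd, where c = c]) auto
  also have "\<dots> = c\<^sup>2 * scalar_prod r p"
    using mult_mat_vec[OF Ac S(1), of c] S P(1) by (simp add: quad_form_def power2_eq_square)
  also have "scalar_prod r p = quad_form (minv A ^\<^sub>m 3) b"
  proof -
    have "minv A ^\<^sub>m 3 *\<^sub>v b = minv A *\<^sub>v r"
      using G b P(1) S(1)
      by (simp add: numeral_3_eq_3 p_def r_def assoc_mult_mat_vec[of _ ?n ?n _ ?n])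
    \<comment> \<open>Self-adjointness of \<open>minv A\<close> is drawn from that of
      \<open>A\<close> by writing b = Ap and r = As.\<close>
    moreover have "scalar_prod b (minv A *\<^sub>v r) = scalar_prod p r"
    proof -
      define s where "s = minv A *\<^sub>v r"
      note Si = inv[OF S(1), folded s_def]
      have "scalar_prod b s = scalar_prod s (A *\<^sub>v p)"
        using P(2) b Si(1) by (simp add: comm_scalar_prod[of _ ?n])
      also have "\<dots> = scalar_prod p (A *\<^sub>v s)" using psd P(1) Si(1) by (auto simp: sym_psd_def)
      finally show ?thesis using Si(2) by (simp add: s_def)
    qed
    ultimately show ?thesis using P S by (simp add: quad_form_def comm_scalar_prod[of _ ?n])
  qed
  finally have le: "quad_form A (p - q) \<le> c\<^sup>2 * quad_form (minv A ^\<^sub>m 3) b" .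
  have "norm (K (vec_comb q \<psi>) - K (vec_comb p \<psi>)) = norm (K (vec_comb (p - q) \<psi>))"
    using P(1) R(2) by (simp add: K_vec_comb_diff norm_minus_commute)
  also have "\<dots> = sqrt (quad_form A (p - q))"
    using P(1) R(2) norm_K_vec_comb[of "p - q" \<psi>] by (simp add: A_def)
  also have "\<dots> \<le> sqrt (c\<^sup>2 * quad_form (minv A ^\<^sub>m 3) b)"
    using le by (rule real_sqrt_le_mono)
  finally show ?thesis using c by (simp add: p_def q_def real_sqrt_mult)
qed

text \<open>
  The operator \<open>Q\<close> of the theorem is \<open>K \<circ> nystroem_proj \<phi>\<close>, where \<open>nystroem_proj \<phi>\<close> is the projection
  onto the span of \<open>\<phi>\<close> that is orthogonal for the inner product \<open>[\<alpha>, K \<beta>]\<close>.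
\<close>

definition nystroem_proj :: "('u \<Rightarrow>\<^sub>L real) list \<Rightarrow> ('u \<Rightarrow>\<^sub>L real) \<Rightarrow> ('u \<Rightarrow>\<^sub>L real)" where
  "nystroem_proj \<phi> \<beta> = vec_comb (minv (op_mat K \<phi> \<phi>) *\<^sub>v pairing \<phi> (K \<beta>)) \<phi>"

text \<open>K(T\<beta>) and K\<beta> agree under every functional in \<phi>, hence under T\<alpha>,
  which is a combination of \<phi>. Using this in both orders together with \<open>sym\<close> moves
  \<open>T\<close> across the pairing.\<close>

lemma nystroem_proj_sym:
  assumes indep: "lin_indep_list \<phi>"
  defines "T \<equiv> nystroem_proj \<phi>"
  shows "blinfun_apply (T \<alpha>) (K (T \<beta>)) = blinfun_apply \<alpha> (K (T \<beta>))"
proof -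
  note C = gram_minv(2,3)[OF indep pairing_carrier]
  have "pairing \<phi> (K (T \<beta>)) = pairing \<phi> (K \<beta>)" for \<beta>
    using C by (simp add: T_def nystroem_proj_def op_mat_mult_vec[OF linear, symmetric])
  then have "blinfun_apply (T \<alpha>) (K (T \<beta>)) = blinfun_apply (T \<alpha>) (K \<beta>)" for \<alpha> \<beta>
    using C(1) by (simp add: T_def[unfolded nystroem_proj_def] blinfun_vec_comb)
  then show ?thesis by (metis sym)
qed

text \<open>The element v is known only through matrix products. Reading them as the inverse Gram
  matrix applied to the column [\<phi>, K\<beta>] identifies the value of every functional on v, and
  functionals separate points.\<close>

lemma nystroem_eq:
  assumes indep: "lin_indep_list \<phi>"
    and Q: "\<And>\<alpha>. blinfun_apply \<alpha> v =
        (op_mat K [\<alpha>] \<phi> * minv (op_mat K \<phi> \<phi>) * op_mat K \<phi> [\<beta>]) $$ (0, 0)"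
  shows "v = K (nystroem_proj \<phi> \<beta>)"
proof (rule eq_of_functionals)
  fix \<alpha>
  let ?G = "minv (op_mat K \<phi> \<phi>)" and ?n = "length \<phi>"
  note G = gram_minv(1)[OF indep]
  have col: "col (op_mat K \<phi> [\<beta>]) 0 = pairing \<phi> (K \<beta>)"
    by (intro eq_vecI) (auto simp: op_mat_def pairing_def)
  have "op_mat K [\<alpha>] \<phi> * ?G * op_mat K \<phi> [\<beta>] = op_mat K [\<alpha>] \<phi> * (?G * op_mat K \<phi> [\<beta>])"
    by (rule assoc_mult_mat[OF op_mat_carrier G op_mat_carrier])
  then have "blinfun_apply \<alpha> v = scalar_prod (row (op_mat K [\<alpha>] \<phi>) 0) (col (?G * op_mat K \<phi> [\<beta>]) 0)"
    unfolding Q using G by (simp add: op_mat_def)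
  also have "col (?G * op_mat K \<phi> [\<beta>]) 0 = ?G *\<^sub>v col (op_mat K \<phi> [\<beta>]) 0"
    by (rule col_mult2[OF G op_mat_carrier]) auto
  also have "scalar_prod (row (op_mat K [\<alpha>] \<phi>) 0) (?G *\<^sub>v col (op_mat K \<phi> [\<beta>]) 0) =
      (op_mat K [\<alpha>] \<phi> *\<^sub>v (?G *\<^sub>v pairing \<phi> (K \<beta>))) $ 0"
    unfolding col by (simp add: op_mat_def)
  also have "\<dots> = blinfun_apply \<alpha> (K (nystroem_proj \<phi> \<beta>))"
    using G by (simp add: op_mat_mult_vec[OF linear] nystroem_proj_def pairing_def)
  finally show "blinfun_apply \<alpha> v = blinfun_apply \<alpha> (K (nystroem_proj \<phi> \<beta>))" .
qed

end

section \<open>Stationarity of the regularized least squares problem\<close>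

lemma quadratic_nonneg_imp_linear_0:
  fixes b c :: real
  assumes "\<And>t. 0 \<le> 2 * t * b + t\<^sup>2 * c"
  shows "b = 0"
proof (rule ccontr)
  assume "b \<noteq> 0"
  \<comment> \<open>At t = -b/e the quadratic equals
    \<open>(b\<^sup>2 / e\<^sup>2) * (c - 2 * e)\<close>; this e is positive and exceeds c/2, so the
    value is negative.\<close>
  define e where "e = \<bar>c\<bar> + 1"
  have "e > 0" "c < 2 * e" by (auto simp: e_def)
  have "2 * (- b / e) * b + (- b / e)\<^sup>2 * c = (b\<^sup>2 / e\<^sup>2) * (c - 2 * e)"
    using \<open>e > 0\<close> by (simp add: field_simps power2_eq_square)
  also have "\<dots> < 0"
    using \<open>b \<noteq> 0\<close> \<open>e > 0\<close> \<open>c < 2 * e\<close> by (intro mult_pos_neg) auto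
  finally show False using assms[of "- b / e"] by simp
qed

lemma inner_product_on_self_nonneg:
  assumes "is_inner_product_on H ip" "u \<in> H"
  shows "0 \<le> ip u u"
proof (cases "u = 0")
  case True
  \<comment> \<open>Positivity is given only for nonzero elements; at 0 the value follows from
    linearity with both coefficients zero.\<close>
  note conjunct1[OF assms(1)[unfolded is_inner_product_on_def], rule_format,
      OF assms(2) assms(2) assms(2), of 0 0]
  with True show ?thesis by simp
next
  case False
  then have "ip u u > 0" using assms by (simp add: is_inner_product_on_def)
  then show ?thesis by simp
qed

text \<open>First variation along u + th: the coefficient linear in t must vanish. The result is the
  normal equation for the sampling operator, tested against h.\<close>

lemma regularized_least_squares_stationary:
  assumes H: "subspace H" "is_inner_product_on H ip"
    and u: "u \<in> H" and h: "h \<in> H" and z: "z \<in> carrier_vec (length \<psi>)"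
    and min: "\<And>v. v \<in> H \<Longrightarrow> (vnorm (pairing \<psi> u - z))\<^sup>2 + \<gamma> * ip u u
        \<le> (vnorm (pairing \<psi> v - z))\<^sup>2 + \<gamma> * ip v v"
  shows "\<gamma> * ip u h = scalar_prod (z - pairing \<psi> u) (pairing \<psi> h)"
proof -
  let ?n = "length \<psi>"
  define d where "d = pairing \<psi> u - z"
  define s where "s = pairing \<psi> h"
  have d: "d \<in> carrier_vec ?n" and s: "s \<in> carrier_vec ?n"
    using z by (auto simp: d_def s_def)
  have lin: "ip (a *\<^sub>R u' + b *\<^sub>R v) w = a * ip u' w + b * ip v w"
    if "u' \<in> H" "v \<in> H" "w \<in> H" for a b u' v w
    using H(2) that by (auto simp: is_inner_product_on_def)
  have sym: "ip v w = ip w v" if "v \<in> H" "w \<in> H" for v w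
    using H(2) that by (auto simp: is_inner_product_on_def)
  have "0 \<le> 2 * t * (scalar_prod d s + \<gamma> * ip u h) + t\<^sup>2 * (scalar_prod s s + \<gamma> * ip h h)" for t
  proof -
    define v where "v = u + t *\<^sub>R h"
    have v: "v \<in> H" unfolding v_def using H(1) u h by (intro subspace_add subspace_scale)
    have "pairing \<psi> v - z = d + t \<cdot>\<^sub>v s"
      using z by (intro eq_vecI) (auto simp: v_def d_def s_def pairing_def blinfun.add_right blinfun.scaleR_right)
    then have "(vnorm (pairing \<psi> v - z))\<^sup>2 = scalar_prod (d + t \<cdot>\<^sub>v s) (d + t \<cdot>\<^sub>v s)"
      by (simp add: vnorm_power2)
    also have "\<dots> = scalar_prod d d + 2 * t * scalar_prod d s + t\<^sup>2 * scalar_prod s s"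
      using d s by (simp add: add_scalar_prod_distrib[of _ ?n]
          scalar_prod_add_distrib[of _ ?n] comm_scalar_prod[of s ?n d] power2_eq_square algebra_simps)
    finally have "(vnorm (pairing \<psi> v - z))\<^sup>2 =
        scalar_prod d d + 2 * t * scalar_prod d s + t\<^sup>2 * scalar_prod s s" .
    moreover have "ip v v = ip u u + 2 * t * ip u h + t\<^sup>2 * ip h h"
      using lin[OF u h v, of 1 t] lin[OF u h u, of 1 t] lin[OF u h h, of 1 t]
        sym[OF u v] sym[OF h v] sym[OF h u]
      by (simp add: v_def[symmetric] power2_eq_square algebra_simps)
    moreover have "(vnorm (pairing \<psi> u - z))\<^sup>2 = scalar_prod d d"
      by (simp add: d_def vnorm_power2)
    ultimately show ?thesis using min[OF v] by (simp add: algebra_simps)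
  qed
  then have "scalar_prod d s + \<gamma> * ip u h = 0" by (rule quadratic_nonneg_imp_linear_0)
  moreover have "scalar_prod (z - pairing \<psi> u) s = - scalar_prod d s"
    using z s by (simp add: d_def minus_scalar_prod_distrib[of _ ?n])
  ultimately show ?thesis by (simp add: s_def)
qed

theorem theorem3p7:
  fixes \<Omega> :: "'a::euclidean_space set"
    and ev :: "'u::banach \<Rightarrow> 'a \<Rightarrow> real"
    and K Q :: "('u \<Rightarrow>\<^sub>L real) \<Rightarrow> 'u"
    and Db D :: nat
    and L :: "nat \<Rightarrow> 'u \<Rightarrow> 'a \<Rightarrow> real"
    and P B :: "real vec \<Rightarrow> real"
    and f g :: "'a \<Rightarrow> real"
    and ustar :: 'u
    and M\<Omega> M N\<Omega> N :: nat
    and xhat x :: "nat \<Rightarrow> 'a"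
    and \<phi> \<psi> :: "('u \<Rightarrow>\<^sub>L real) list"
    and UQ :: "'u set"
    and ipQ :: "'u \<Rightarrow> 'u \<Rightarrow> real"
    and R :: nat
    and F :: "real vec \<Rightarrow> real vec"
    and y :: "real vec"
    and \<gamma> :: real
    and udag :: 'u
    and zdag :: "real vec"
  assumes Omega: "open \<Omega>" "connected \<Omega>" "bounded \<Omega>" "\<Omega> \<noteq> {}"
    and space: "function_space_on (closure \<Omega>) ev"
    and K_linear_bij: "linear K" "bij K"
    and K_sym: "\<And>\<alpha> \<beta>. blinfun_apply \<alpha> (K \<beta>) = blinfun_apply \<beta> (K \<alpha>)"
    and K_pos: "\<And>\<alpha>. \<alpha> \<noteq> 0 \<Longrightarrow> blinfun_apply \<alpha> (K \<alpha>) > 0"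
    and norm_K: "\<And>u. (norm u)\<^sup>2 = blinfun_apply (inv_into UNIV K u) u"
    and D: "1 \<le> Db" "Db \<le> D"
    and L_bd: "\<And>i. i \<in> {1..Db} \<Longrightarrow> bounded_operator_into_C (frontier \<Omega>) (L i)"
    and L_int: "\<And>i. i \<in> {Db+1..D} \<Longrightarrow> bounded_operator_into_C \<Omega> (L i)"
    and ustar: "strong_solution \<Omega> Db D L P B f g ustar"
    and ustar_unique: "\<And>u. strong_solution \<Omega> Db D L P B f g u \<Longrightarrow> u = ustar"
    and inducing: "M\<Omega> \<le> M" "\<And>j. j \<in> {1..M\<Omega>} \<Longrightarrow> xhat j \<in> \<Omega>"
      "\<And>j. j \<in> {M\<Omega>+1..M} \<Longrightarrow> xhat j \<in> frontier \<Omega>"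
    and phi: "\<phi> = colloc_functionals L xhat (colloc_index Db D M\<Omega> M)"
    and phi_indep: "lin_indep_list \<phi>"
    and Q: "\<And>\<alpha> \<beta>. blinfun_apply \<alpha> (Q \<beta>) =
        (op_mat K [\<alpha>] \<phi> * minv (op_mat K \<phi> \<phi>) * op_mat K \<phi> [\<beta>]) $$ (0, 0)"
    and UQ: "is_rkhs (closure \<Omega>) ev
        (\<lambda>s t. blinfun_apply (at_point ev s) (Q (at_point ev t))) UQ ipQ"
    and samples: "N\<Omega> \<le> N" "\<And>j. j \<in> {1..N\<Omega>} \<Longrightarrow> x j \<in> \<Omega>"
      "\<And>j. j \<in> {N\<Omega>+1..N} \<Longrightarrow> x j \<in> frontier \<Omega>"
    and R: "R = colloc_dim Db D N\<Omega> N"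
    and psi: "\<psi> = colloc_functionals L x (colloc_index Db D N\<Omega> N)"
    and psi_indep: "lin_indep_list \<psi>"
    and F: "F = constraint_map Db D N\<Omega> N P B"
    and y: "y = data_vec N\<Omega> N x f g"
    and gamma: "\<gamma> > 0"
    and solution: "is_arg_min
        (\<lambda>(u, z). (vnorm (pairing \<psi> u - z))\<^sup>2 + \<gamma> * (sqrt (ipQ u u))\<^sup>2)
        (\<lambda>(u, z). u \<in> UQ \<and> z \<in> carrier_vec R \<and> F z = y) (udag, zdag)"
    and udag: "udag = regularized_inverse Q UQ \<psi> \<gamma> (sampling_adjoint Q \<psi> zdag)"
    and zdag: "is_arg_min (quad_form (minv (op_mat Q \<psi> \<psi> + \<gamma> \<cdot>\<^sub>m 1\<^sub>m R)))
        (\<lambda>z. z \<in> carrier_vec R \<and> F z = y) zdag"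
  shows "norm (udag - ustar)
    \<le> (INF \<alpha> \<in> span (set \<psi>). norm (ustar - K \<alpha>))
      + \<gamma> * sqrt (quad_form (minv (op_mat K \<psi> \<psi>) ^\<^sub>m 3) (pairing \<psi> ustar))
      + sqrt 3 * vnorm zdag
        * sqrt (spectral_norm (minv (\<gamma> \<cdot>\<^sub>m 1\<^sub>m R + op_mat Q \<psi> \<psi>) - minv (\<gamma> \<cdot>\<^sub>m 1\<^sub>m R + op_mat K \<psi> \<psi>)))
      + sqrt (quad_form (minv (op_mat K \<psi> \<psi>)) (zdag - pairing \<psi> ustar))"
proof -
  interpret covariance_operator K
    using K_linear_bij K_sym K_pos norm_K by (rule covariance_operator.intro)
  define T where "T = nystroem_proj \<phi>"
  define \<psi>' where "\<psi>' = map T \<psi>"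
  define A where "A = op_mat K \<psi> \<psi>"
  define C where "C = op_mat Q \<psi> \<psi>"
  define b where "b = pairing \<psi> ustar"
  have len: "length \<psi> = R" "length \<psi>' = R"
    using length_colloc_index[OF D(2)] by (simp_all add: psi R colloc_functionals_def \<psi>'_def)
  have QT: "Q \<beta> = K (T \<beta>)" for \<beta>
    unfolding T_def using Q by (intro nystroem_eq[OF phi_indep])
  have Tsym: "blinfun_apply (T \<alpha>) (K (T \<beta>)) = blinfun_apply \<alpha> (K (T \<beta>))" for \<alpha> \<beta>
    unfolding T_def by (rule nystroem_proj_sym[OF phi_indep])
  have Tswap: "blinfun_apply \<alpha> (K (T \<beta>)) = blinfun_apply \<beta> (K (T \<alpha>))" for \<alpha> \<beta>
    using Tsym[of \<alpha> \<beta>] Tsym[of \<beta> \<alpha>] sym[of "T \<alpha>" "T \<beta>"] by simp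
  \<comment> \<open>Since \<open>T\<close> is a projection that is symmetric for the pairing through
    \<open>K\<close>, three Gram matrices coincide with \<open>C\<close>. Hence \<open>C\<close>
    also represents the cross term in the distance between \<open>udag\<close> and
    \<open>u1\<close>.\<close>
  have C': "C = op_mat K \<psi>' \<psi>'" "C = op_mat K \<psi> \<psi>'"
    by (intro eq_matI; simp add: C_def op_mat_def \<psi>'_def QT Tsym)+
  have C'': "C = op_mat K \<psi>' \<psi>"
  proof (intro eq_matI)
    fix i j assume "i < dim_row (op_mat K \<psi>' \<psi>)" "j < dim_col (op_mat K \<psi>' \<psi>)"
    then show "C $$ (i, j) = op_mat K \<psi>' \<psi> $$ (i, j)"
      using Tswap[of "\<psi> ! i" "\<psi> ! j"] sym[of "T (\<psi> ! i)" "\<psi> ! j"]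
      by (simp add: C'(2) op_mat_def \<psi>'_def)
  qed (simp_all add: C'(2) op_mat_def \<psi>'_def)
  have A: "sym_psd R A" and C: "sym_psd R C"
    using gram_sym_psd[of \<psi>] gram_sym_psd[of \<psi>'] by (simp_all add: A_def C'(1) len)
  have Ac: "A \<in> carrier_mat R R" using A by (simp add: sym_psd_def)
  have b: "b \<in> carrier_vec R" by (simp add: b_def flip: len(1))

  \<comment> \<open>The minimizer as a combination of the functions Q\<psi>\<close>
  have udag_UQ: "udag \<in> UQ" and z: "zdag \<in> carrier_vec R" and Fz: "F zdag = y"
    using solution by (auto simp: is_arg_min_def)
  have H: "subspace UQ" "is_inner_product_on UQ ipQ"
    and rep: "\<And>s. s \<in> closure \<Omega> \<Longrightarrow> \<exists>h\<in>UQ. (\<forall>t\<in>closure \<Omega>. ev h t =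
      blinfun_apply (at_point ev t) (Q (at_point ev s))) \<and> (\<forall>u\<in>UQ. ipQ u h = ev u s)"
    using UQ by (auto simp: is_rkhs_def is_hilbert_on_def)
  \<comment> \<open>Freezing the second component at \<open>zdag\<close> keeps the constraint
    satisfied and leaves a minimization over u alone. Nonnegativity of \<open>ipQ\<close> on the
    diagonal removes the squared root.\<close>
  have minimal: "(vnorm (pairing \<psi> udag - zdag))\<^sup>2 + \<gamma> * ipQ udag udag
      \<le> (vnorm (pairing \<psi> v - zdag))\<^sup>2 + \<gamma> * ipQ v v" if "v \<in> UQ" for v
    using solution[unfolded is_arg_min_linorder, THEN conjunct2, rule_format, of "(v, zdag)"] that z Fz
      inner_product_on_self_nonneg[OF H(2) that] inner_product_on_self_nonneg[OF H(2) udag_UQ]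
    by simp
  \<comment> \<open>Testing stationarity against the kernel sections \<open>Q \<delta>\<^sub>s\<close> gives \<open>\<gamma> u\<^sup>\<dagger> = S\<^sup>* (z\<^sup>\<dagger> - S u\<^sup>\<dagger>)\<close> pointwise.\<close>
  define a where "a = (1 / \<gamma>) \<cdot>\<^sub>v (zdag - pairing \<psi> udag)"
  have a: "a \<in> carrier_vec R" using z by (auto simp: a_def pairing_def len)
  have ev: "blinfun_apply (at_point ev s) u = ev u s" if "s \<in> closure \<Omega>" for s u
    using space that by (simp add: function_space_on_def at_point_def bounded_linear_Blinfun_apply)
  have udag_eq: "udag = K (vec_comb a \<psi>')"
  proof -
    have "ev udag s = ev (K (vec_comb a \<psi>')) s" if s: "s \<in> closure \<Omega>" for s
    proof -
      let ?q = "Q (at_point ev s)"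
      obtain h where h: "h \<in> UQ" "\<And>t. t \<in> closure \<Omega> \<Longrightarrow> ev h t = ev ?q t" "ipQ udag h = ev udag s"
        using rep[OF s] udag_UQ ev by auto
      \<comment> \<open>Equal values on the closure identify the reproducing element h with the
        kernel section, which thereby lies in \<open>UQ\<close> and can serve as a test
        function.\<close>
      then have "h = ?q" using space by (auto simp: function_space_on_def)
      have "\<gamma> * ev udag s = scalar_prod (zdag - pairing \<psi> udag) (pairing \<psi> ?q)"
        using regularized_least_squares_stationary[OF H udag_UQ h(1) _ minimal] z h(3) \<open>h = ?q\<close>
        by (simp add: len)
      then have "ev udag s = scalar_prod a (pairing \<psi> ?q)"
        using gamma z len by (simp add: a_def pairing_def field_simps)
      also have "\<dots> = blinfun_apply (vec_comb a \<psi>) (K (T (at_point ev s)))"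
        using a by (simp add: blinfun_vec_comb len QT)
      also have "\<dots> = (\<Sum>k<R. a $ k * blinfun_apply (\<psi> ! k) (K (T (at_point ev s))))"
        by (simp add: vec_comb_def len blinfun.sum_left blinfun.scaleR_left)
      \<comment> \<open>Symmetry of K T exchanges each sampling functional with the evaluation at
        s.\<close>
      also have "\<dots> = (\<Sum>k<R. a $ k * blinfun_apply (at_point ev s) (K (T (\<psi> ! k))))"
        using Tswap by simp
      also have "\<dots> = blinfun_apply (at_point ev s) (K (vec_comb a \<psi>'))"
        unfolding linear_vec_comb[OF linear] using len
        by (simp add: vec_comb_def \<psi>'_def blinfun.sum_right blinfun.scaleR_right)
      finally show ?thesis using ev[OF s] by simp
    qed
    then show ?thesis using space by (auto simp: function_space_on_def)
  qed
  have Ca: "C *\<^sub>v a + \<gamma> \<cdot>\<^sub>v a = zdag"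
  proof -
    have "C *\<^sub>v a = pairing \<psi> udag"
      using a by (simp add: C'(2) op_mat_mult_vec[OF linear] len udag_eq)
    moreover have "\<gamma> \<cdot>\<^sub>v a = zdag - pairing \<psi> udag"
      using gamma by (simp add: a_def smult_smult_assoc)
    ultimately show ?thesis
      using z len by (intro eq_vecI) (auto simp: pairing_def)
  qed

  \<comment> \<open>Estimates of the four distances along the chain\<close>
  let ?G = "minv (\<gamma> \<cdot>\<^sub>m 1\<^sub>m R + C)" and ?E = "minv (\<gamma> \<cdot>\<^sub>m 1\<^sub>m R + A)"
  define e where "e = ?E *\<^sub>v zdag"
  define u1 where "u1 = K (vec_comb e \<psi>)"
  define u2 where "u2 = K (vec_comb (?E *\<^sub>v b) \<psi>)"
  define u3 where "u3 = K (vec_comb (minv A *\<^sub>v b) \<psi>)"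
  note G = regularized_minv[OF C gamma]
  note E = regularized_minv[OF A gamma]
  have a_eq: "a = ?G *\<^sub>v zdag" using G(4)[OF a] Ca by simp
  have e: "e \<in> carrier_vec R" and Ae: "A *\<^sub>v e + \<gamma> \<cdot>\<^sub>v e = zdag"
    using E(2,3)[OF z] by (simp_all add: e_def)

  \<comment> \<open>Factor 1 suffices here in place of \<open>sqrt 3\<close>.\<close>
  have t3: "norm (udag - u1) \<le> vnorm zdag * sqrt (spectral_norm (?G - ?E))"
  proof -
    have "(norm (udag - u1))\<^sup>2 =
        scalar_prod a (C *\<^sub>v a) - 2 * scalar_prod a (C *\<^sub>v e) + scalar_prod e (A *\<^sub>v e)"
      unfolding udag_eq u1_def norm_K_diff
      using a e gram[of a \<psi>' a \<psi>'] gram[of a \<psi>' e \<psi>] gram[of e \<psi> e \<psi>]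
      by (simp add: len A_def C'(1)[symmetric] C''[symmetric])
    also have "\<dots> = scalar_prod zdag (a - e) - \<gamma> * scalar_prod (a - e) (a - e)"
      by (rule regularized_difference[OF Ac C a e Ca Ae])
    also have "\<dots> \<le> scalar_prod zdag (a - e)"
      using gamma scalar_prod_self_nonneg[of "a - e"] by simp
    also have "a - e = (?G - ?E) *\<^sub>v zdag"
      unfolding a_eq e_def by (rule minus_mult_distrib_mat_vec[OF G(1)[OF z] E(1)[OF z] z, symmetric])
    also have "scalar_prod zdag ((?G - ?E) *\<^sub>v zdag) \<le> (vnorm zdag)\<^sup>2 * spectral_norm (?G - ?E)"
      by (rule scalar_prod_mult_mat_vec_le[OF minus_carrier_mat[OF E(1)[OF z]] z])
    finally have "sqrt ((norm (udag - u1))\<^sup>2) \<le> sqrt ((vnorm zdag)\<^sup>2 * spectral_norm (?G - ?E))"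
      by (rule real_sqrt_le_mono)
    then show ?thesis by (simp add: real_sqrt_mult vnorm_nonneg)
  qed
  \<comment> \<open>The product is nonnegative because \<open>t3\<close> bounds a norm by it, so the
    larger factor preserves the estimate.\<close>
  moreover have "1 * (vnorm zdag * sqrt (spectral_norm (?G - ?E)))
      \<le> sqrt 3 * (vnorm zdag * sqrt (spectral_norm (?G - ?E)))"
    using order_trans[OF norm_ge_zero t3] by (intro mult_right_mono) auto
  moreover have "norm (u1 - u2) \<le> sqrt (quad_form (minv A) (zdag - b))"
  proof -
    have "u1 - u2 = K (vec_comb (?E *\<^sub>v (zdag - b)) \<psi>)"
      using K_vec_comb_diff[of e \<psi> "?E *\<^sub>v b"] e E(2)[OF b] len
        mult_minus_distrib_mat_vec[OF E(1)[OF z] z b]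
      by (simp add: u1_def u2_def e_def)
    then show ?thesis
      using norm_regularized_le[OF psi_indep gamma, of "zdag - b"] z b by (simp add: len A_def)
  qed
  moreover have "norm (u2 - u3) \<le> \<gamma> * sqrt (quad_form (minv A ^\<^sub>m 3) b)"
    using norm_regularization_bias_le[OF psi_indep gamma, of b] b by (simp add: u2_def u3_def len A_def)
  \<comment> \<open>The estimate holds against every competitor in the span; the zero functional
    makes the set under the infimum nonempty.\<close>
  moreover have "norm (ustar - u3) \<le> (INF \<alpha> \<in> span (set \<psi>). norm (ustar - K \<alpha>))"
    unfolding u3_def A_def b_def
    by (intro cINF_greatest interpolant_optimal psi_indep) (auto intro: span_zero)
  moreover have "norm (udag - ustar)
      \<le> norm (udag - u1) + norm (u1 - u2) + norm (u2 - u3) + norm (ustar - u3)"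
    by norm
  ultimately show ?thesis unfolding A_def[symmetric] b_def[symmetric] C_def[symmetric] by linarith
qed

end
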